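(* For every integer base $p\ge2$, $\Sigma_2\text{-}\mathbf{BA}_p=\mathbf{BA}_p$.
   Context: Büchi arithmetic of base $p$ is the first-order theory of $\langle\mathbb{N},0,1,+,V_p\rangle$, where $V_p(a,b)$ holds iff $a$ is the largest power of $p$ dividing $b$ (i.e. $a=p^k$, $a\mid b$, $pa\nmid b$), and $V_p(a,0)$ never holds. $\Sigma_i\text{-}\mathbf{BA}_p$ is the family of sets $\{m\in\mathbb{N}:\Phi(m)\text{ holds}\}$ for $\Sigma_i$-formulas $\Phi(x)$ (prenex, at most $i$ alternating quantifier blocks beginning with $\exists$) of Büchi arithmetic of base $p$; $\mathbf{BA}_p=\bigcup_{i\ge1}\Sigma_i\text{-}\mathbf{BA}_p$. *)

theory Defs
  imports Main
begin

text \<open>First-order syntax over the signature \<open>0, 1, +, V\<close> with equality. Variables are named by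
  natural numbers; no substitution is ever needed. Both quantifiers are primitive, since the
  quantifier hierarchy below is about prenex formulas.\<close>

datatype ba_term =
    Var nat
  | Zero
  | One
  | Plus ba_term ba_term

datatype ba_form =
    Eq ba_term ba_term
  | V ba_term ba_term
  | Neg ba_form
  | Conj ba_form ba_form
  | Disj ba_form ba_form
  | Ex nat ba_form
  | All nat ba_form

fun fv_term :: "ba_term \<Rightarrow> nat set" where
  "fv_term (Var x) = {x}"
| "fv_term Zero = {}"
| "fv_term One = {}"
| "fv_term (Plus s t) = fv_term s \<union> fv_term t"

fun fv :: "ba_form \<Rightarrow> nat set" where
  "fv (Eq s t) = fv_term s \<union> fv_term t"
| "fv (V s t) = fv_term s \<union> fv_term t"
| "fv (Neg \<phi>) = fv \<phi>"
| "fv (Conj \<phi> \<psi>) = fv \<phi> \<union> fv \<psi>"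
| "fv (Disj \<phi> \<psi>) = fv \<phi> \<union> fv \<psi>"
| "fv (Ex x \<phi>) = fv \<phi> - {x}"
| "fv (All x \<phi>) = fv \<phi> - {x}"

definition Vp :: "nat \<Rightarrow> nat \<Rightarrow> nat \<Rightarrow> bool" where
  "Vp p a b \<longleftrightarrow> (\<exists>k. a = p ^ k) \<and> a dvd b \<and> \<not> p * a dvd b"

lemma Vp_zero: "\<not> Vp p a 0"
  by (simp add: Vp_def)

fun eval_term :: "(nat \<Rightarrow> nat) \<Rightarrow> ba_term \<Rightarrow> nat" where
  "eval_term e (Var x) = e x"
| "eval_term e Zero = 0"
| "eval_term e One = 1"
| "eval_term e (Plus s t) = eval_term e s + eval_term e t"

fun sat :: "nat \<Rightarrow> (nat \<Rightarrow> nat) \<Rightarrow> ba_form \<Rightarrow> bool" where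
  "sat p e (Eq s t) \<longleftrightarrow> eval_term e s = eval_term e t"
| "sat p e (V s t) \<longleftrightarrow> Vp p (eval_term e s) (eval_term e t)"
| "sat p e (Neg \<phi>) \<longleftrightarrow> \<not> sat p e \<phi>"
| "sat p e (Conj \<phi> \<psi>) \<longleftrightarrow> sat p e \<phi> \<and> sat p e \<psi>"
| "sat p e (Disj \<phi> \<psi>) \<longleftrightarrow> sat p e \<phi> \<or> sat p e \<psi>"
| "sat p e (Ex x \<phi>) \<longleftrightarrow> (\<exists>n. sat p (e(x := n)) \<phi>)"
| "sat p e (All x \<phi>) \<longleftrightarrow> (\<forall>n. sat p (e(x := n)) \<phi>)"

lemma eval_term_cong: "(\<And>x. x \<in> fv_term t \<Longrightarrow> e x = e' x) \<Longrightarrow> eval_term e t = eval_term e' t"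
  by (induction t) auto

lemma sat_cong: "(\<And>x. x \<in> fv \<phi> \<Longrightarrow> e x = e' x) \<Longrightarrow> sat p e \<phi> \<longleftrightarrow> sat p e' \<phi>"
proof (induction \<phi> arbitrary: e e')
  case (Eq s t)
  then show ?case using eval_term_cong[of s e e'] eval_term_cong[of t e e'] by simp
next
  case (V s t)
  then show ?case using eval_term_cong[of s e e'] eval_term_cong[of t e e'] by simp
next
  case (Neg \<phi>)
  then show ?case by (metis fv.simps(3) sat.simps(3))
next
  case (Conj \<phi> \<psi>)
  then show ?case by (metis UnCI fv.simps(4) sat.simps(4))
next
  case (Disj \<phi> \<psi>)
  then show ?case by (metis UnCI fv.simps(5) sat.simps(5))
next
  case (Ex x \<phi>)
  have "sat p (e(x := n)) \<phi> \<longleftrightarrow> sat p (e'(x := n)) \<phi>" for n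
    by (rule Ex.IH) (use Ex.prems in auto)
  then show ?case by simp
next
  case (All x \<phi>)
  have "sat p (e(x := n)) \<phi> \<longleftrightarrow> sat p (e'(x := n)) \<phi>" for n
    by (rule All.IH) (use All.prems in auto)
  then show ?case by simp
qed

fun qfree :: "ba_form \<Rightarrow> bool" where
  "qfree (Eq s t) \<longleftrightarrow> True"
| "qfree (V s t) \<longleftrightarrow> True"
| "qfree (Neg \<phi>) \<longleftrightarrow> qfree \<phi>"
| "qfree (Conj \<phi> \<psi>) \<longleftrightarrow> qfree \<phi> \<and> qfree \<psi>"
| "qfree (Disj \<phi> \<psi>) \<longleftrightarrow> qfree \<phi> \<and> qfree \<psi>"
| "qfree (Ex x \<phi>) \<longleftrightarrow> False"
| "qfree (All x \<phi>) \<longleftrightarrow> False"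

text \<open>Prenex formulas with at most \<open>i\<close> alternating blocks, the outermost being existential
  (\<open>is_Sigma\<close>) or universal (\<open>is_Pi\<close>). A block is any finite sequence of quantifiers of one kind,
  possibly empty; hence the classes are cumulative.\<close>

inductive is_Sigma :: "nat \<Rightarrow> ba_form \<Rightarrow> bool"
  and is_Pi :: "nat \<Rightarrow> ba_form \<Rightarrow> bool" where
  Sigma_qfree: "qfree \<phi> \<Longrightarrow> is_Sigma 0 \<phi>"
| Pi_qfree: "qfree \<phi> \<Longrightarrow> is_Pi 0 \<phi>"
| Sigma_Pi: "is_Pi i \<phi> \<Longrightarrow> is_Sigma (Suc i) \<phi>"
| Pi_Sigma: "is_Sigma i \<phi> \<Longrightarrow> is_Pi (Suc i) \<phi>"
| Sigma_Ex: "is_Sigma (Suc i) \<phi> \<Longrightarrow> is_Sigma (Suc i) (Ex x \<phi>)"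
| Pi_All: "is_Pi (Suc i) \<phi> \<Longrightarrow> is_Pi (Suc i) (All x \<phi>)"

text \<open>Only \<open>x\<close> may occur free in the formula, so by \<open>sat_cong\<close> the values of the other
  variables are irrelevant; they are set to \<open>0\<close>.\<close>

definition Sigma_BA :: "nat \<Rightarrow> nat \<Rightarrow> nat set set" where
  "Sigma_BA i p = {{m. sat p ((\<lambda>_. 0)(x := m)) \<phi>} | x \<phi>. is_Sigma i \<phi> \<and> fv \<phi> \<subseteq> {x}}"

definition BA :: "nat \<Rightarrow> nat set set" where
  "BA p = (\<Union>i\<in>{1..}. Sigma_BA i p)"

end

theory Submission
  imports Defs
begin

text \<open>Reading the digits in base \<open>p\<close> of all variables simultaneously, least significant
  first, turns a set of assignments into its residuals. Having a finite set of iterated residuals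
  is preserved by Boolean operations and, since the residuals of a projection are unions of
  projections of residuals, by quantification; hence every definable set has it. For a definable
  \<open>A \<subseteq> \<nat>\<close> the residuals are the states of a deterministic automaton. To say that it accepts
  \<open>m\<close>, guess for every state \<open>i\<close> a number \<open>y\<^sub>i\<close> whose nonzero digits mark the times at which
  the run may be in \<open>i\<close>, and then require universally that the initial state is marked, that
  the marks are propagated up to the length of \<open>m\<close>, and that no rejecting state is marked
  beyond it. Digits at a power of \<open>p\<close> are unique, so they can be extracted by
  universally quantified variables in the premises.\<close>

section \<open>Sets of assignments with finitely many residuals\<close>

text \<open>The left quotient by the letter \<open>d\<close>: with least significant digits first,
  \<open>d\<close> has just been read and \<open>e\<close> is the unread remainder.\<close>

definition residual :: "nat \<Rightarrow> (nat \<Rightarrow> nat) \<Rightarrow> (nat \<Rightarrow> nat) set \<Rightarrow> (nat \<Rightarrow> nat) set" where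
  "residual p d R = {e. (\<lambda>x. p * e x + d x) \<in> R}"

text \<open>A condition in the style of Myhill and Nerode, with \<open>F\<close> as state set. Any
  finite family closed under residuals will do, so the closure proofs only have to exhibit a large
  enough one.\<close>

definition automatic :: "nat \<Rightarrow> (nat \<Rightarrow> nat) set \<Rightarrow> bool" where
  "automatic p R \<longleftrightarrow>
    (\<exists>F. finite F \<and> R \<in> F \<and> (\<forall>S\<in>F. \<forall>d. (\<forall>x. d x < p) \<longrightarrow> residual p d S \<in> F))"

lemma automaticI:
  assumes "finite F" "R \<in> F" "\<And>S d. S \<in> F \<Longrightarrow> (\<And>x. d x < p) \<Longrightarrow> residual p d S \<in> F"
  shows "automatic p R"
  using assms unfolding automatic_def by blast

lemma automaticE:
  assumes "automatic p R"
  obtains F where "finite F" "R \<in> F"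
    "\<And>S d. S \<in> F \<Longrightarrow> (\<And>x. d x < p) \<Longrightarrow> residual p d S \<in> F"
  using assms unfolding automatic_def by blast

section \<open>Closure under Boolean operations and projection\<close>

lemma automatic_Compl:
  assumes "automatic p R"
  shows "automatic p (- R)"
proof -
  from assms obtain F where F: "finite F" "R \<in> F"
    "\<And>S d. S \<in> F \<Longrightarrow> (\<And>x. d x < p) \<Longrightarrow> residual p d S \<in> F"
    by (rule automaticE) blast
  show ?thesis
  proof (rule automaticI)
    show "finite (uminus ` F)" "- R \<in> uminus ` F" using F by auto
    fix S and d :: "nat \<Rightarrow> nat" assume S: "S \<in> uminus ` F" and d: "\<And>x. d x < p"
    then obtain T where T: "T \<in> F" "S = - T" by blast
    have "residual p d S = - residual p d T" by (auto simp: residual_def T)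
    then show "residual p d S \<in> uminus ` F" using F(3)[OF T(1), of d] d by simp
  qed
qed

lemma automatic_Int:
  assumes "automatic p R" "automatic p R'"
  shows "automatic p (R \<inter> R')"
proof -
  from assms(1) obtain F where F: "finite F" "R \<in> F"
    "\<And>S d. S \<in> F \<Longrightarrow> (\<And>x. d x < p) \<Longrightarrow> residual p d S \<in> F"
    by (rule automaticE) blast
  from assms(2) obtain F' where F': "finite F'" "R' \<in> F'"
    "\<And>S d. S \<in> F' \<Longrightarrow> (\<And>x. d x < p) \<Longrightarrow> residual p d S \<in> F'"
    by (rule automaticE) blast
  let ?G = "(\<lambda>(S, T). S \<inter> T) ` (F \<times> F')"
  show ?thesis
  proof (rule automaticI)
    show "finite ?G" "R \<inter> R' \<in> ?G" using F F' by auto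
    fix U and d :: "nat \<Rightarrow> nat" assume U: "U \<in> ?G" and d: "\<And>x. d x < p"
    then obtain S T where ST: "S \<in> F" "T \<in> F'" "U = S \<inter> T" by auto
    have "residual p d U = residual p d S \<inter> residual p d T" by (auto simp: residual_def ST)
    then show "residual p d U \<in> ?G" using F(3)[OF ST(1), of d] F'(3)[OF ST(2), of d] d by auto
  qed
qed

lemma automatic_Un:
  assumes "automatic p R" "automatic p R'"
  shows "automatic p (R \<union> R')"
proof -
  have "R \<union> R' = - (- R \<inter> - R')" by blast
  then show ?thesis using assms by (simp only: automatic_Compl automatic_Int)
qed

text \<open>The coordinate \<open>x\<close> is not dropped but made irrelevant, so that all sets
  remain sets of full assignments.\<close>

definition proj :: "nat \<Rightarrow> (nat \<Rightarrow> nat) set \<Rightarrow> (nat \<Rightarrow> nat) set" where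
  "proj x R = {e. \<exists>n. e(x := n) \<in> R}"

text \<open>The witness \<open>n\<close> splits into its lowest digit \<open>c\<close>, guessed now
  in place of \<open>d x\<close>, and \<open>n div p\<close>, guessed later: a nondeterministic
  step.\<close>

lemma residual_proj:
  assumes "p > 0"
  shows "residual p d (proj x R) = proj x (\<Union>c<p. residual p (d(x := c)) R)"
proof -
  have upd: "(\<lambda>y. p * (e(x := n)) y + (d(x := c)) y) = (\<lambda>y. p * e y + d y)(x := p * n + c)" for e n c
    by auto
  have "(\<exists>n. (\<lambda>y. p * e y + d y)(x := n) \<in> R) \<longleftrightarrow>
    (\<exists>n. \<exists>c<p. (\<lambda>y. p * e y + d y)(x := p * n + c) \<in> R)" for e
  proof
    assume "\<exists>n. (\<lambda>y. p * e y + d y)(x := n) \<in> R"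
    then obtain n where "(\<lambda>y. p * e y + d y)(x := n) \<in> R" ..
    then have "(\<lambda>y. p * e y + d y)(x := p * (n div p) + n mod p) \<in> R" by simp
    moreover have "n mod p < p" using assms by simp
    ultimately show "\<exists>n. \<exists>c<p. (\<lambda>y. p * e y + d y)(x := p * n + c) \<in> R" by blast
  qed blast
  then show ?thesis
    unfolding proj_def residual_def upd UN_iff mem_Collect_eq by (auto simp: upd)
qed

text \<open>Subset construction: residuals commute with unions, and \<open>residual_proj\<close>
  leads from a set of states to the set of all their successors.\<close>

lemma automatic_proj:
  assumes "p > 0" "automatic p R"
  shows "automatic p (proj x R)"
proof -
  from assms(2) obtain F where F: "finite F" "R \<in> F"
    "\<And>S d. S \<in> F \<Longrightarrow> (\<And>x. d x < p) \<Longrightarrow> residual p d S \<in> F"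
    by (rule automaticE) blast
  let ?G = "(\<lambda>G. proj x (\<Union>G)) ` Pow F"
  show ?thesis
  proof (rule automaticI)
    show "finite ?G" using F by simp
    have "proj x R = proj x (\<Union>{R})" by simp
    then show "proj x R \<in> ?G" using F(2) by blast
    fix U and d :: "nat \<Rightarrow> nat" assume U: "U \<in> ?G" and d: "\<And>x. d x < p"
    then obtain G where G: "G \<subseteq> F" "U = proj x (\<Union>G)" by auto
    let ?H = "\<Union>c<p. residual p (d(x := c)) ` G"
    have "(\<Union>c<p. residual p (d(x := c)) (\<Union>G)) = \<Union>?H"
      by (auto simp: residual_def)
    then have "residual p d U = proj x (\<Union>?H)" using residual_proj[OF assms(1)] G(2) by simp
    moreover have "?H \<subseteq> F"
    proof
      fix T assume "T \<in> ?H"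
      then obtain c S where "c < p" "S \<in> G" "T = residual p (d(x := c)) S" by auto
      with G(1) d show "T \<in> F" using F(3)[of S "d(x := c)"] by auto
    qed
    ultimately show "residual p d U \<in> ?G" by blast
  qed
qed

section \<open>Linear equations\<close>

text \<open>The term without its constant summand, hence linear in the assignment; integer-valued so
  that two sides can be subtracted.\<close>

definition lin :: "ba_term \<Rightarrow> (nat \<Rightarrow> nat) \<Rightarrow> int" where
  "lin t e = int (eval_term e t) - int (eval_term (\<lambda>_. 0) t)"

lemma lin_affine: "lin t (\<lambda>x. p * e x + d x) = int p * lin t e + lin t d"
  by (induction t) (auto simp: lin_def algebra_simps)

text \<open>\<open>lin t (\<lambda>_. 1)\<close> is the sum of the coefficients of \<open>t\<close>,
  and each digit is at most \<open>p - 1\<close>.\<close>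

lemma lin_bounds:
  assumes "\<And>x. d x < p"
  shows "0 \<le> lin t d \<and> lin t d \<le> (int p - 1) * lin t (\<lambda>_. 1)"
proof (induction t)
  case (Var x)
  then show ?case using assms[of x] by (simp add: lin_def)
next
  case (Plus s t)
  then show ?case by (simp add: lin_def algebra_simps)
qed (auto simp: lin_def)

text \<open>The states are the equations \<open>L e + c = 0\<close> with bounded \<open>c\<close>,
  and the empty set. Reading \<open>d\<close> leaves \<open>p * L e + (L d + c) = 0\<close>: either
  \<open>L e + k = 0\<close> with the carry \<open>k = (L d + c) / p\<close>, or unsolvable if
  \<open>p\<close> does not divide. From \<open>\<bar>c\<bar> \<le> M\<close> and
  \<open>\<bar>L d\<bar> \<le> (p - 1) * M\<close> follows
  \<open>\<bar>k\<bar> \<le> M\<close>.\<close>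

lemma automatic_Eq:
  assumes p: "p > 0"
  shows "automatic p {e. eval_term e s = eval_term e t}"
proof -
  define L where "L e = lin s e - lin t e" for e
  define c\<^sub>0 where "c\<^sub>0 = int (eval_term (\<lambda>_. 0) s) - int (eval_term (\<lambda>_. 0) t)"
  define M where "M = \<bar>c\<^sub>0\<bar> + lin s (\<lambda>_. 1) + lin t (\<lambda>_. 1)"
  \<comment> \<open>The assignment that is constantly 1 is a digit vector in base 2.\<close>
  have nonneg: "0 \<le> lin r (\<lambda>_. 1)" for r by (rule lin_bounds[of "\<lambda>_. 1" 2, THEN conjunct1]) simp
  let ?A = "\<lambda>c. {e. L e + c = 0}"
  let ?F = "insert {} (?A ` {-M..M})"
  show ?thesis
  proof (rule automaticI)
    show "finite ?F" by simp
    have "{e. eval_term e s = eval_term e t} = ?A c\<^sub>0"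
      by (auto simp: L_def c\<^sub>0_def lin_def)
    moreover have "c\<^sub>0 \<in> {-M..M}" using nonneg[of s] nonneg[of t] by (auto simp: M_def)
    ultimately show "{e. eval_term e s = eval_term e t} \<in> ?F" by blast
    fix U and d :: "nat \<Rightarrow> nat" assume U: "U \<in> ?F" and d: "\<And>x. d x < p"
    show "residual p d U \<in> ?F"
    proof (cases "U = {}")
      case True
      then show ?thesis by (simp add: residual_def)
    next
      case False
      then obtain c where c: "c \<in> {-M..M}" "U = ?A c" using U by blast
      have res: "residual p d U = {e. int p * L e + (L d + c) = 0}"
        unfolding residual_def c(2) mem_Collect_eq L_def lin_affine by (simp add: algebra_simps)
      show ?thesis
      proof (cases "int p dvd L d + c")
        case True
        then obtain k where k: "L d + c = int p * k" by blast
        have "residual p d U = ?A k"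
        proof -
          have "int p * L e + int p * k = 0 \<longleftrightarrow> L e + k = 0" for e
            using p by (simp flip: distrib_left)
          then show ?thesis unfolding res k by simp
        qed
        moreover have "k \<in> {-M..M}"
        proof -
          have "\<bar>L d\<bar> \<le> (int p - 1) * lin s (\<lambda>_. 1) + (int p - 1) * lin t (\<lambda>_. 1)"
            using lin_bounds[of d p s, OF d] lin_bounds[of d p t, OF d] unfolding L_def by linarith
          also have "\<dots> \<le> (int p - 1) * M"
            unfolding distrib_left[symmetric] using p by (intro mult_left_mono) (auto simp: M_def)
          finally have "\<bar>int p * k\<bar> \<le> (int p - 1) * M + M"
            unfolding k[symmetric] using c(1) by auto
          then have "int p * \<bar>k\<bar> \<le> int p * M" by (simp add: abs_mult algebra_simps)
          then show ?thesis using p by auto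
        qed
        ultimately show ?thesis by blast
      next
        case False
        have "int p * L e + (L d + c) \<noteq> 0" for e
        proof
          assume "int p * L e + (L d + c) = 0"
          then have "L d + c = int p * (- L e)" by simp
          with False show False by (metis dvd_triv_left)
        qed
        then show ?thesis unfolding res by simp
      qed
    qed
  qed
qed

section \<open>The predicate \<open>V\<close>\<close>

text \<open>If \<open>b\<close> is nonzero, 1 is the only power of \<open>p\<close> dividing the
  second number. If \<open>b = 0\<close>, the largest such power is a multiple of \<open>p\<close>,
  and one factor \<open>p\<close> cancels.\<close>

lemma Vp_digits:
  assumes p: "p \<ge> 2" and a: "a < p" and b: "b < p"
  shows "Vp p (p * m + a) (p * n + b) \<longleftrightarrow>
    (if b = 0 then a = 0 \<and> Vp p m n else a = 1 \<and> m = 0)"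
proof -
  have pow: "(\<exists>k. p * m + a = p ^ k) \<longleftrightarrow> (m = 0 \<and> a = 1) \<or> (a = 0 \<and> (\<exists>k. m = p ^ k))"
  proof
    assume "\<exists>k. p * m + a = p ^ k"
    then obtain k where k: "p * m + a = p ^ k" ..
    show "(m = 0 \<and> a = 1) \<or> (a = 0 \<and> (\<exists>k. m = p ^ k))"
    proof (cases k)
      case 0
      then show ?thesis using k p by (cases m) auto
    next
      case (Suc j)
      have "(p * m + a) mod p = a" using a by simp
      then have "a = 0" using k Suc by simp
      then show ?thesis using k Suc p by auto
    qed
  next
    assume "(m = 0 \<and> a = 1) \<or> (a = 0 \<and> (\<exists>k. m = p ^ k))"
    then show "\<exists>k. p * m + a = p ^ k"
    proof
      assume "m = 0 \<and> a = 1" then show ?thesis by (intro exI[of _ 0]) simp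
    next
      assume "a = 0 \<and> (\<exists>k. m = p ^ k)"
      then obtain k where "a = 0" "m = p ^ k" by blast
      then show ?thesis by (intro exI[of _ "Suc k"]) simp
    qed
  qed
  have "p dvd b \<longleftrightarrow> b = 0" using b by (cases "b = 0") (auto simp: nat_dvd_not_less)
  then have b_dvd: "p dvd p * n + b \<longleftrightarrow> b = 0"
    using dvd_add_right_iff[of p "p * n" b] by simp
  have mult_dvd: "p * j dvd p * n + b \<longleftrightarrow> b = 0 \<and> j dvd n" for j
  proof (cases "b = 0")
    case True
    then show ?thesis using p by simp
  next
    case False
    then show ?thesis using b_dvd dvd_mult_left by blast
  qed
  show ?thesis
  proof (cases "m = 0 \<and> a = 1")
    case True
    then show ?thesis using b_dvd p by (auto simp: Vp_def intro: exI[of _ 0])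
  next
    case False
    show ?thesis
    proof (cases "a = 0")
      case True
      then show ?thesis using pow mult_dvd[of m] mult_dvd[of "p * m"] False
        by (auto simp: Vp_def)
    next
      case F: False
      then show ?thesis using pow False by (auto simp: Vp_def)
    qed
  qed
qed

text \<open>Three states: still reading common zeros; power completed, so the rest of
  \<open>y\<close> must be 0; failure.\<close>

lemma automatic_V_Var:
  assumes p: "p \<ge> 2"
  shows "automatic p {e. Vp p (e y) (e z)}"
proof (rule automaticI)
  let ?F = "{{}, {e. e y = 0}, {e. Vp p (e y) (e z)}}"
  show "finite ?F" "{e. Vp p (e y) (e z)} \<in> ?F" by auto
  fix S and d :: "nat \<Rightarrow> nat" assume S: "S \<in> ?F" and d: "\<And>x. d x < p"
  have A: "residual p d {e. e y = 0} = (if d y = 0 then {e. e y = 0} else {})"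
    using p by (auto simp: residual_def)
  have B: "residual p d {e. Vp p (e y) (e z)} =
    (if d z = 0 then if d y = 0 then {e. Vp p (e y) (e z)} else {}
     else if d y = 1 then {e. e y = 0} else {})"
    using Vp_digits[OF p d d] by (auto simp: residual_def)
  have "residual p d {} = {}" by (simp add: residual_def)
  then show "residual p d S \<in> ?F"
    using S unfolding insert_iff empty_iff by (elim disjE) (simp_all add: A B)
qed

text \<open>Fresh variables \<open>y\<close> and \<open>z\<close> name the terms and are projected
  away afterwards.\<close>

lemma automatic_V:
  assumes p: "p \<ge> 2"
  shows "automatic p {e. Vp p (eval_term e s) (eval_term e t)}"
proof -
  have fin: "finite (fv_term r)" for r by (induction r) auto
  obtain y where y: "y \<notin> fv_term s \<union> fv_term t"
    using ex_new_if_finite[OF infinite_UNIV_nat, of "fv_term s \<union> fv_term t"] fin by auto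
  obtain z where z: "z \<notin> insert y (fv_term s \<union> fv_term t)"
    using ex_new_if_finite[OF infinite_UNIV_nat, of "insert y (fv_term s \<union> fv_term t)"] fin by auto
  have "eval_term (e(y := a, z := b)) s = eval_term e s"
    "eval_term (e(y := a, z := b)) t = eval_term e t" for e a b
    using y z by (auto intro!: eval_term_cong)
  then have "{e. Vp p (eval_term e s) (eval_term e t)} =
    proj y (proj z ({e. eval_term e (Var y) = eval_term e s} \<inter>
      ({e. eval_term e (Var z) = eval_term e t} \<inter> {e. Vp p (e y) (e z)})))"
    using z by (auto simp: proj_def)
  then show ?thesis
    using p by (simp only: automatic_proj automatic_Int automatic_Eq automatic_V_Var)
qed

section \<open>Definable sets\<close>

lemma automatic_sat:
  assumes p: "p \<ge> 2"
  shows "automatic p {e. sat p e \<phi>}"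
proof (induction \<phi>)
  case (Eq s t)
  then show ?case using p by (simp add: automatic_Eq)
next
  case (V s t)
  then show ?case using automatic_V[OF p] by simp
next
  case (Neg \<phi>)
  then show ?case using automatic_Compl by (simp add: Collect_neg_eq)
next
  case (Conj \<phi> \<psi>)
  then show ?case using automatic_Int by (simp add: Collect_conj_eq)
next
  case (Disj \<phi> \<psi>)
  then show ?case using automatic_Un by (simp add: Collect_disj_eq)
next
  case (Ex x \<phi>)
  then show ?case using automatic_proj[of p _ x] p by (fastforce simp: proj_def)
next
  case (All x \<phi>)
  have "{e. sat p e (All x \<phi>)} = - proj x (- {e. sat p e \<phi>})" by (auto simp: proj_def)
  then show ?case using All p by (simp only: automatic_Compl automatic_proj)
qed

text \<open>Setting all variables but \<open>x\<close> to 0 is compatible with reading digits,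
  because their digits are then 0 too. So the slices \<open>u R\<close> inherit closure under
  residuals.\<close>

lemma finite_residuals_definable:
  assumes p: "p \<ge> 2" and A: "A \<in> BA p"
  obtains F where "finite F" "A \<in> F"
    "\<And>S c. S \<in> F \<Longrightarrow> c < p \<Longrightarrow> {m. p * m + c \<in> S} \<in> F"
proof -
  from A obtain x \<phi> where \<phi>: "A = {m. sat p ((\<lambda>_. 0)(x := m)) \<phi>}"
    unfolding BA_def Sigma_BA_def by blast
  from automatic_sat[OF p, of \<phi>] obtain F where F: "finite F" "{e. sat p e \<phi>} \<in> F"
    "\<And>S d. S \<in> F \<Longrightarrow> (\<And>x. d x < p) \<Longrightarrow> residual p d S \<in> F"
    by (rule automaticE) blast
  define u where "u R = {m. (\<lambda>_. 0)(x := m) \<in> R}" for R :: "(nat \<Rightarrow> nat) set"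
  show thesis
  proof (rule that)
    show "finite (u ` F)" using F(1) by simp
    show "A \<in> u ` F" using F(2) \<phi> by (intro image_eqI[of _ _ "{e. sat p e \<phi>}"]) (simp_all add: u_def)
    fix S c assume "S \<in> u ` F" and c: "c < p"
    then obtain R where R: "R \<in> F" "S = u R" by blast
    let ?d = "(\<lambda>_. 0)(x := c)"
    have "(\<lambda>y. p * ((\<lambda>_. 0)(x := m)) y + ?d y) = (\<lambda>_. 0)(x := p * m + c)" for m by auto
    then have "{m. p * m + c \<in> S} = u (residual p ?d R)" by (simp add: R u_def residual_def)
    moreover have "residual p ?d R \<in> F" using F(3)[OF R(1)] c by simp
    ultimately show "{m. p * m + c \<in> S} \<in> u ` F" by blast
  qed
qed

section \<open>Digits in base \<open>p\<close>\<close>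

text \<open>The divisibility by \<open>p * P\<close> is expressed without quantifiers: \<open>P\<close> divides \<open>w\<close>, and
  the digit of \<open>w\<close> at \<open>P\<close> is not \<open>p - b\<close> for any \<open>b\<close> between \<open>1\<close> and \<open>p - 1\<close>.\<close>

lemma Vp_shifts_iff:
  assumes p: "p \<ge> 2"
  shows "(\<forall>b\<in>{1..<p}. Vp p P (b * P + w)) \<longleftrightarrow> (\<exists>k. P = p ^ k) \<and> p * P dvd w"
proof
  assume L: "\<forall>b\<in>{1..<p}. Vp p P (b * P + w)"
  moreover have "1 \<in> {1..<p}" using p by simp
  ultimately have V1: "Vp p P (1 * P + w)" by blast
  then obtain k where k: "P = p ^ k" by (auto simp: Vp_def)
  have "P dvd w" using V1 by (simp add: Vp_def)
  then obtain q where q: "w = P * q" by blast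
  have "q mod p = 0"
  proof (rule ccontr)
    assume nz: "q mod p \<noteq> 0"
    moreover have "q mod p < p" using p by simp
    \<comment> \<open>This shift would complete the digit of \<open>w\<close> to \<open>p\<close>
      and make the sum divisible by \<open>p * P\<close>.\<close>
    ultimately have "p - q mod p \<in> {1..<p}" by auto
    with L have "\<not> p * P dvd (p - q mod p) * P + w" by (auto simp: Vp_def)
    moreover have "(p - q mod p) + q = p * (1 + q div p)"
    proof -
      have "q mod p \<le> p" using p by (simp add: less_imp_le)
      moreover have "q = p * (q div p) + q mod p" by simp
      ultimately show ?thesis unfolding distrib_left mult_1_right by linarith
    qed
    then have "(p - q mod p) * P + w = p * P * (1 + q div p)"
      unfolding q by (metis (no_types, lifting) distrib_right mult.assoc mult.commute)
    ultimately show False by simp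
  qed
  then have "p dvd q" by (rule dvd_eq_mod_eq_0[THEN iffD2])
  then show "(\<exists>k. P = p ^ k) \<and> p * P dvd w" using k q by (auto simp: mult.commute)
next
  assume "(\<exists>k. P = p ^ k) \<and> p * P dvd w"
  then obtain k where k: "P = p ^ k" and w: "p * P dvd w" by blast
  show "\<forall>b\<in>{1..<p}. Vp p P (b * P + w)"
  proof
    fix b assume b: "b \<in> {1..<p}"
    have "P dvd w" using w by (rule dvd_mult_right)
    moreover have "\<not> p * P dvd b * P + w"
    proof
      assume "p * P dvd b * P + w"
      then have "p * P dvd b * P" using w by (simp add: dvd_add_left_iff)
      then have "p dvd b" using k p by simp
      then show False using b by (auto dest: dvd_imp_le)
    qed
    ultimately show "Vp p P (b * P + w)" using k by (auto simp: Vp_def)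
  qed
qed

text \<open>\<open>u\<close> is the part of \<open>x\<close> below the digit and \<open>w\<close>
  the part above it. The slack \<open>z\<close> expresses \<open>u < P\<close> by an equation, as
  the signature has no order.\<close>

lemma digit_decomposition:
  fixes p P c x :: nat
  assumes p: "p \<ge> 2" and P: "P = p ^ k" and c: "c < p"
  shows "(\<exists>u z w. x = u + (c * P + w) \<and> P = u + z + 1 \<and> p * P dvd w) \<longleftrightarrow> x div P mod p = c"
proof
  assume "\<exists>u z w. x = u + (c * P + w) \<and> P = u + z + 1 \<and> p * P dvd w"
  then obtain u z w where *: "x = u + (c * P + w)" "P = u + z + 1" and "p * P dvd w" by blast
  then obtain q where "w = p * P * q" by blast
  then have "x = u + P * (c + p * q)" unfolding *(1) by (simp only: distrib_left mult_ac)
  moreover have "u < P" using *(2) by simp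
  ultimately have "x div P = c + p * q" by simp
  then show "x div P mod p = c" using c by simp
next
  assume c: "x div P mod p = c"
  have Pp: "P > 0" using P p by simp
  have "x = x mod P + P * (x div P)" by simp
  also have "x div P = c + p * (x div P div p)" using c by auto
  finally have "x = x mod P + (c * P + p * P * (x div P div p))" by (simp add: algebra_simps)
  moreover have "P = x mod P + (P - x mod P - 1) + 1" using Pp by (simp add: Suc_leI)
  ultimately show "\<exists>u z w. x = u + (c * P + w) \<and> P = u + z + 1 \<and> p * P dvd w"
    using dvd_triv_left by blast
qed

text \<open>One number codes a finite set of positions; in the induction, the digit for position 0
  is put below the code of the shifted set.\<close>

lemma ex_number_with_digits:
  assumes p: "p \<ge> (2::nat)" and S: "\<And>j. S j \<Longrightarrow> j < N"
  shows "\<exists>y. \<forall>j. y div p ^ j mod p = of_bool (S j)"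
  using S
proof (induction N arbitrary: S)
  case 0
  then show ?case by (intro exI[of _ 0]) auto
next
  case (Suc N)
  have "\<exists>y. \<forall>j. y div p ^ j mod p = of_bool (S (Suc j))"
    using Suc.prems by (intro Suc.IH) auto
  then obtain y where y: "y div p ^ j mod p = of_bool (S (Suc j))" for j by blast
  let ?y = "of_bool (S 0) + p * y"
  have "?y div p ^ j mod p = of_bool (S j)" for j
  proof (cases j)
    case 0
    then show ?thesis using p by simp
  next
    case (Suc i)
    have "?y div p = y" using p by simp
    then have "?y div p ^ j = y div p ^ i" unfolding Suc by (simp add: div_mult2_eq)
    then show ?thesis using y[of i] Suc by simp
  qed
  then show ?case by blast
qed

section \<open>Runs of automata\<close>

text \<open>Once the digits of \<open>m\<close> are exhausted, the run goes on reading
  zeros.\<close>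

fun run :: "nat \<Rightarrow> (nat \<Rightarrow> nat \<Rightarrow> nat) \<Rightarrow> nat \<Rightarrow> nat \<Rightarrow> nat \<Rightarrow> nat" where
  "run p \<delta> i m 0 = i"
| "run p \<delta> i m (Suc k) = \<delta> (run p \<delta> i m k) (m div p ^ k mod p)"

text \<open>\<open>K i\<close> is the language of state \<open>i\<close>, so \<open>m\<close> is
  accepted iff 0 lies in the language of the state reached at time \<open>N\<close>, the length of
  \<open>m\<close>. Marks off the run do no harm: a marking that contains the initial state and is
  propagated up to \<open>N\<close> contains the run up to \<open>N\<close>, whose last state then
  cannot reject. Propagation has to end because a number has only finitely many nonzero
  digits.\<close>

lemma accepts_iff_marking:
  fixes K :: "nat \<Rightarrow> nat set"
  assumes p: "p \<ge> 2" and i\<^sub>0: "i\<^sub>0 < n"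
    and \<delta>: "\<And>i c. i < n \<Longrightarrow> c < p \<Longrightarrow> \<delta> i c < n"
    and K: "\<And>i c. i < n \<Longrightarrow> c < p \<Longrightarrow> K (\<delta> i c) = {m. p * m + c \<in> K i}"
  shows "m \<in> K i\<^sub>0 \<longleftrightarrow> (\<exists>Y.
    Y i\<^sub>0 mod p \<noteq> 0 \<and>
    (\<forall>i<n. \<forall>k. p ^ k \<le> m \<longrightarrow> Y i div p ^ k mod p \<noteq> 0 \<longrightarrow>
      Y (\<delta> i (m div p ^ k mod p)) div p ^ Suc k mod p \<noteq> 0) \<and>
    (\<forall>i<n. \<forall>k. 0 \<notin> K i \<longrightarrow> m < p ^ k \<longrightarrow> Y i div p ^ k mod p = 0))"
    (is "_ \<longleftrightarrow> (\<exists>Y. ?marking Y)")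
proof -
  let ?q = "run p \<delta> i\<^sub>0 m"
  have q_less: "?q k < n" for k using i\<^sub>0 \<delta> p by (induction k) auto
  have mem: "m \<in> K i\<^sub>0 \<longleftrightarrow> m div p ^ k \<in> K (?q k)" for k
  proof (induction k)
    case (Suc k)
    have "K (?q (Suc k)) = {j. p * j + m div p ^ k mod p \<in> K (?q k)}"
      using K[OF q_less, of "m div p ^ k mod p" k] p by simp
    moreover have "m div p ^ Suc k = m div p ^ k div p"
      by (simp only: power_Suc2 div_mult2_eq)
    ultimately show ?case using Suc by simp
  qed simp
  have "m < 2 ^ m" by (rule less_exp)
  also have "\<dots> \<le> p ^ m" using p by (rule power_mono) simp
  finally have ex: "\<exists>N. m < p ^ N" by blast
  define N where "N = (LEAST N. m < p ^ N)"
  have N: "m < p ^ N" unfolding N_def using ex by (rule LeastI_ex)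
  have less_N: "p ^ k \<le> m" if "k < N" for k
    using that not_less_Least[of k "\<lambda>N. m < p ^ N"] by (auto simp: N_def)
  have acc: "m \<in> K i\<^sub>0 \<longleftrightarrow> 0 \<in> K (?q N)" using mem[of N] N by simp
  show ?thesis
  proof
    assume "m \<in> K i\<^sub>0"
    then have accN: "0 \<in> K (?q N)" using acc by simp
    \<comment> \<open>Mark exactly the run, including time \<open>N\<close>, which the last
      propagation step reaches; hence the strict bound \<open>Suc N\<close>.\<close>
    have "\<forall>i. \<exists>y. \<forall>k. y div p ^ k mod p = of_bool (k \<le> N \<and> ?q k = i)"
      by (intro allI ex_number_with_digits[OF p, of _ "Suc N"]) simp
    then obtain Y where Y: "Y i div p ^ k mod p = of_bool (k \<le> N \<and> ?q k = i)" for i k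
      by metis
    have "Y i\<^sub>0 mod p \<noteq> 0" using Y[of i\<^sub>0 0] by simp
    moreover have less: "k < N" if "p ^ k \<le> m" for k
    proof (rule ccontr)
      assume "\<not> k < N"
      then have "p ^ N \<le> p ^ k" using p by (intro power_increasing) auto
      then show False using N that by simp
    qed
    have "Y (\<delta> i (m div p ^ k mod p)) div p ^ Suc k mod p \<noteq> 0"
      if "p ^ k \<le> m" "Y i div p ^ k mod p \<noteq> 0" for i k
      using that less[of k] unfolding Y by (auto simp: Suc_le_eq)
    \<comment> \<open>A mark forces \<open>k \<le> N\<close> and \<open>m < p ^ k\<close> forces
      \<open>k \<ge> N\<close>, so only the accepting state at time \<open>N\<close>
      matters.\<close>
    moreover have "Y i div p ^ k mod p = 0" if "0 \<notin> K i" "m < p ^ k" for i k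
      using that accN less_N[of k] unfolding Y by (cases "k < N") (auto simp: le_less)
    ultimately show "\<exists>Y. ?marking Y" by blast
  next
    assume "\<exists>Y. ?marking Y"
    then obtain Y where init: "Y i\<^sub>0 mod p \<noteq> 0"
      and step: "\<forall>i<n. \<forall>k. p ^ k \<le> m \<longrightarrow> Y i div p ^ k mod p \<noteq> 0 \<longrightarrow>
        Y (\<delta> i (m div p ^ k mod p)) div p ^ Suc k mod p \<noteq> 0"
      and final: "\<forall>i<n. \<forall>k. 0 \<notin> K i \<longrightarrow> m < p ^ k \<longrightarrow> Y i div p ^ k mod p = 0"
      by (elim exE conjE)
    have "k \<le> N \<Longrightarrow> Y (?q k) div p ^ k mod p \<noteq> 0" for k
    proof (induction k)
      case 0
      then show ?case using init by simp
    next
      case (Suc k)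
      then have "p ^ k \<le> m" "Y (?q k) div p ^ k mod p \<noteq> 0" using less_N[of k] by auto
      then have "Y (\<delta> (?q k) (m div p ^ k mod p)) div p ^ Suc k mod p \<noteq> 0"
        using step q_less[of k] by simp
      then show ?case unfolding run.simps .
    qed
    from this[OF le_refl] have "Y (?q N) div p ^ N mod p \<noteq> 0" .
    then have "0 \<in> K (?q N)" using final q_less[of N] N by (metis (no_types))
    then show "m \<in> K i\<^sub>0" using acc by simp
  qed
qed

section \<open>The \<open>\<Sigma>\<^sub>2\<close> formula\<close>

text \<open>A block is read as a single choice of an assignment, so that order and repetition of its
  variables become immaterial.\<close>

lemma sat_Exs:
  "sat p e (foldr Ex xs \<phi>) \<longleftrightarrow> (\<exists>g. (\<forall>v. v \<notin> set xs \<longrightarrow> g v = e v) \<and> sat p g \<phi>)"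
proof (induction xs arbitrary: e)
  case Nil
  have "g = e" if "\<forall>v. g v = e v" for g using that by auto
  then show ?case by auto
next
  case (Cons x xs)
  show ?case
  proof
    assume "sat p e (foldr Ex (x # xs) \<phi>)"
    then obtain n g where "\<forall>v. v \<notin> set xs \<longrightarrow> g v = (e(x := n)) v" "sat p g \<phi>"
      using Cons.IH by auto
    then show "\<exists>g. (\<forall>v. v \<notin> set (x # xs) \<longrightarrow> g v = e v) \<and> sat p g \<phi>"
      by (intro exI[of _ g]) auto
  next
    assume "\<exists>g. (\<forall>v. v \<notin> set (x # xs) \<longrightarrow> g v = e v) \<and> sat p g \<phi>"
    then obtain g where "\<forall>v. v \<notin> set (x # xs) \<longrightarrow> g v = e v" "sat p g \<phi>" by blast
    then have "sat p (e(x := g x)) (foldr Ex xs \<phi>)" unfolding Cons.IH by (auto intro!: exI[of _ g])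
    then show "sat p e (foldr Ex (x # xs) \<phi>)" by auto
  qed
qed

lemma sat_Alls:
  "sat p e (foldr All xs \<phi>) \<longleftrightarrow> (\<forall>g. (\<forall>v. v \<notin> set xs \<longrightarrow> g v = e v) \<longrightarrow> sat p g \<phi>)"
proof -
  have "sat p e (foldr All xs \<phi>) \<longleftrightarrow> \<not> sat p e (foldr Ex xs (Neg \<phi>))" for e
    by (induction xs arbitrary: e) auto
  then show ?thesis by (auto simp: sat_Exs)
qed

lemma fv_Exs: "fv (foldr Ex xs \<phi>) = fv \<phi> - set xs"
  by (induction xs) auto

lemma fv_Alls: "fv (foldr All xs \<phi>) = fv \<phi> - set xs"
  by (induction xs) auto

lemma is_Sigma_2_Exs_Alls: "qfree \<phi> \<Longrightarrow> is_Sigma 2 (foldr Ex xs (foldr All ys \<phi>))"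
proof -
  assume "qfree \<phi>"
  then have "is_Pi (Suc 0) \<phi>" by (intro is_Sigma_is_Pi.intros)
  then have "is_Pi (Suc 0) (foldr All ys \<phi>)" by (induction ys) (auto intro: Pi_All)
  then have "is_Sigma (Suc (Suc 0)) (foldr Ex xs (foldr All ys \<phi>))"
    by (induction xs) (auto intro: Sigma_Pi Sigma_Ex)
  then show ?thesis by (simp add: numeral_2_eq_2)
qed

definition Conjs :: "ba_form list \<Rightarrow> ba_form" where
  "Conjs \<phi>s = foldr Conj \<phi>s (Eq Zero Zero)"

lemma sat_Conjs: "sat p e (Conjs \<phi>s) \<longleftrightarrow> (\<forall>\<phi>\<in>set \<phi>s. sat p e \<phi>)"
  by (induction \<phi>s) (auto simp: Conjs_def)

lemma fv_Conjs: "fv (Conjs \<phi>s) = (\<Union>\<phi>\<in>set \<phi>s. fv \<phi>)"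
  by (induction \<phi>s) (auto simp: Conjs_def)

lemma qfree_Conjs: "qfree (Conjs \<phi>s) \<longleftrightarrow> (\<forall>\<phi>\<in>set \<phi>s. qfree \<phi>)"
  by (induction \<phi>s) (auto simp: Conjs_def)

section \<open>Expressing digits by formulas\<close>

fun times_term :: "nat \<Rightarrow> ba_term \<Rightarrow> ba_term" where
  "times_term 0 t = Zero"
| "times_term (Suc n) t = Plus t (times_term n t)"

lemma eval_times_term: "eval_term e (times_term n t) = n * eval_term e t"
  by (induction n) auto

lemma fv_times_term: "fv_term (times_term n t) \<subseteq> fv_term t"
  by (induction n) auto

text \<open>With suitable values of \<open>v\<close>, \<open>v + 1\<close>, \<open>v + 2\<close>: the digit of \<open>t\<close> at the power \<open>P\<close>
  of \<open>p\<close> is \<open>c\<close>.\<close>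

definition Digit :: "nat \<Rightarrow> ba_term \<Rightarrow> nat \<Rightarrow> ba_term \<Rightarrow> nat \<Rightarrow> ba_form" where
  "Digit p t c P v = Conj (Eq t (Plus (Var v) (Plus (times_term c P) (Var (v + 2)))))
    (Conj (Eq P (Plus (Plus (Var v) (Var (v + 1))) One))
      (Conjs (map (\<lambda>b. V P (Plus (times_term b P) (Var (v + 2)))) [1..<p])))"

text \<open>By \<open>Vp_shifts_iff\<close>, the \<open>V\<close> atoms together say that
  \<open>P\<close> is a power of \<open>p\<close> and that \<open>p * P\<close> divides the value of
  variable \<open>v + 2\<close>.\<close>

lemma sat_Digit:
  assumes "p \<ge> 2"
  shows "sat p e (Digit p t c P v) \<longleftrightarrow>
    (\<exists>k. eval_term e P = p ^ k) \<and> eval_term e t = e v + (c * eval_term e P + e (v + 2)) \<and>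
    eval_term e P = e v + e (v + 1) + 1 \<and> p * eval_term e P dvd e (v + 2)"
  using Vp_shifts_iff[OF assms, of "eval_term e P" "e (v + 2)"]
  by (auto simp: Digit_def sat_Conjs eval_times_term)

text \<open>This direction holds for arbitrary values of the auxiliary variables; only the converse
  needs suitable ones.\<close>

lemma sat_DigitD:
  assumes "p \<ge> 2" "c < p" "sat p e (Digit p t c P v)"
  shows "\<exists>k. eval_term e P = p ^ k" "eval_term e t div eval_term e P mod p = c"
proof -
  have S: "(\<exists>k. eval_term e P = p ^ k) \<and> eval_term e t = e v + (c * eval_term e P + e (v + 2)) \<and>
    eval_term e P = e v + e (v + 1) + 1 \<and> p * eval_term e P dvd e (v + 2)"
    using assms(3) unfolding sat_Digit[OF assms(1)] .
  then show "\<exists>k. eval_term e P = p ^ k" by blast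
  then obtain k where "eval_term e P = p ^ k" ..
  from digit_decomposition[OF assms(1) this assms(2), of "eval_term e t"] S
  show "eval_term e t div eval_term e P mod p = c" by blast
qed

lemma fv_Digit: "fv (Digit p t c P v) \<subseteq> fv_term t \<union> fv_term P \<union> {v, v + 1, v + 2}"
proof -
  have "fv_term (times_term b P) \<subseteq> fv_term P" for b by (rule fv_times_term)
  then show ?thesis unfolding Digit_def by (simp add: fv_Conjs) blast
qed

lemma qfree_Digit: "qfree (Digit p t c P v)"
  by (auto simp: Digit_def qfree_Conjs)

text \<open>Variable \<open>0\<close> holds \<open>m\<close>, variable \<open>1\<close> the power of \<open>p\<close> under consideration,
  variable \<open>2\<close> the difference to \<open>m\<close>; \<open>3\<close> to \<open>11\<close> are used by \<open>Digit\<close>, and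
  \<open>12 + i\<close> holds the marks of the state \<open>i\<close>.\<close>

definition init_cond :: "nat \<Rightarrow> nat \<Rightarrow> ba_form" where
  "init_cond p i = Neg (Digit p (Var (12 + i)) 0 One 3)"

text \<open>Under the negation, the universally quantified auxiliary variables act as existential
  witnesses of the premises. Variable 2 witnesses that the power is at most \<open>m\<close>; the
  conclusion that the digit of \<open>j\<close> is nonzero becomes the premise that it is 0.\<close>

definition step_cond :: "nat \<Rightarrow> nat \<Rightarrow> nat \<Rightarrow> nat \<Rightarrow> nat \<Rightarrow> ba_form" where
  "step_cond p i b c j = Neg (Conj (Eq (Var 0) (Plus (Var 1) (Var 2)))
    (Conj (Digit p (Var 0) c (Var 1) 3)
      (Conj (Digit p (Var (12 + i)) b (Var 1) 6)
        (Digit p (Var (12 + j)) 0 (times_term p (Var 1)) 9))))"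

text \<open>The summand \<open>One\<close> makes the comparison of \<open>m\<close> with the power
  strict.\<close>

definition final_cond :: "nat \<Rightarrow> nat \<Rightarrow> nat \<Rightarrow> ba_form" where
  "final_cond p i b = Neg (Conj (Eq (Var 1) (Plus (Plus (Var 0) (Var 2)) One))
    (Digit p (Var (12 + i)) b (Var 1) 3))"

text \<open>Evaluating under all assignments that agree on \<open>0\<close> and on the marks is what the universal
  block does.\<close>

definition agree :: "nat \<Rightarrow> (nat \<Rightarrow> nat) \<Rightarrow> (nat \<Rightarrow> nat) \<Rightarrow> bool" where
  "agree m Y g \<longleftrightarrow> g 0 = m \<and> (\<forall>i. g (12 + i) = Y i)"

text \<open>\<open>agree\<close> leaves exactly the variables 1 to 11 free, so their values can be
  prescribed.\<close>

lemma ex_agree: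
  "\<exists>g. agree m Y g \<and> g 1 = a1 \<and> g 2 = a2 \<and> g 3 = a3 \<and> g 4 = a4 \<and> g 5 = a5 \<and> g 6 = a6 \<and>
    g 7 = a7 \<and> g 8 = a8 \<and> g 9 = a9 \<and> g 10 = a10 \<and> g 11 = (a11 :: nat)"
  by (rule exI[of _ "\<lambda>v. if v \<ge> 12 then Y (v - 12)
      else [m, a1, a2, a3, a4, a5, a6, a7, a8, a9, a10, a11] ! v"])
    (simp add: agree_def)

section \<open>Meaning of the three conditions\<close>

text \<open>The pattern for all three conditions: a violation yields, by
  \<open>digit_decomposition\<close>, auxiliary values that satisfy the negated formula; conversely,
  an assignment satisfying it determines the digits by \<open>sat_DigitD\<close>.\<close>

lemma init_cond_iff:
  assumes p: "p \<ge> 2"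
  shows "(\<forall>g. agree m Y g \<longrightarrow> sat p g (init_cond p i)) \<longleftrightarrow> Y i mod p \<noteq> 0"
proof
  assume L: "\<forall>g. agree m Y g \<longrightarrow> sat p g (init_cond p i)"
  show "Y i mod p \<noteq> 0"
  proof
    assume "Y i mod p = 0"
    then obtain u z w where D: "Y i = u + (0 * 1 + w)" "1 = u + z + 1" "p * 1 dvd w"
      using digit_decomposition[OF p, of 1 0 0 "Y i"] p by auto
    obtain g where g: "agree m Y g" "g 3 = u" "g 4 = z" "g 5 = w"
      using ex_agree[of m Y 0 0 u z w] by blast
    \<comment> \<open>\<open>One\<close> is the power with exponent 0.\<close>
    have "sat p g (Digit p (Var (12 + i)) 0 One 3)"
      unfolding sat_Digit[OF p] using g D by (intro conjI exI[of _ 0]) (simp_all add: agree_def)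
    with L g(1) show False by (simp add: init_cond_def)
  qed
next
  assume R: "Y i mod p \<noteq> 0"
  show "\<forall>g. agree m Y g \<longrightarrow> sat p g (init_cond p i)"
  proof (intro allI impI)
    fix g assume g: "agree m Y g"
    have False if D: "sat p g (Digit p (Var (12 + i)) 0 One 3)"
    proof -
      have "g (12 + i) mod p = 0" using sat_DigitD(2)[OF p _ D] p by simp
      then show False using R g by (simp add: agree_def)
    qed
    then show "sat p g (init_cond p i)" unfolding init_cond_def sat.simps eval_term.simps by blast
  qed
qed

lemma step_cond_iff:
  assumes p: "p \<ge> 2" and b: "b < p" and c: "c < p"
  shows "(\<forall>g. agree m Y g \<longrightarrow> sat p g (step_cond p i b c j)) \<longleftrightarrow>
    (\<forall>k. p ^ k \<le> m \<longrightarrow> m div p ^ k mod p = c \<longrightarrow> Y i div p ^ k mod p = b \<longrightarrow>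
      Y j div p ^ Suc k mod p \<noteq> 0)"
proof
  assume L: "\<forall>g. agree m Y g \<longrightarrow> sat p g (step_cond p i b c j)"
  show "\<forall>k. p ^ k \<le> m \<longrightarrow> m div p ^ k mod p = c \<longrightarrow> Y i div p ^ k mod p = b \<longrightarrow>
      Y j div p ^ Suc k mod p \<noteq> 0"
  proof (intro allI impI notI)
    fix k assume *: "p ^ k \<le> m" "m div p ^ k mod p = c" "Y i div p ^ k mod p = b"
      "Y j div p ^ Suc k mod p = 0"
    obtain u z w where D1: "m = u + (c * p ^ k + w)" "p ^ k = u + z + 1" "p * p ^ k dvd w"
      using digit_decomposition[OF p refl c, of m k] *(2) by auto
    obtain u' z' w' where D2: "Y i = u' + (b * p ^ k + w')" "p ^ k = u' + z' + 1" "p * p ^ k dvd w'"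
      using digit_decomposition[OF p refl b, of "Y i" k] *(3) by auto
    obtain u'' z'' w'' where D3: "Y j = u'' + (0 * p ^ Suc k + w'')" "p ^ Suc k = u'' + z'' + 1"
      "p * p ^ Suc k dvd w''"
      using digit_decomposition[OF p refl, of 0 "Y j" "Suc k"] *(4) p by auto
    obtain g where g: "agree m Y g" "g 1 = p ^ k" "g 2 = m - p ^ k" "g 3 = u" "g 4 = z" "g 5 = w"
      "g 6 = u'" "g 7 = z'" "g 8 = w'" "g 9 = u''" "g 10 = z''" "g 11 = w''"
      using ex_agree[of m Y "p ^ k" "m - p ^ k" u z w u' z' w' u'' z'' w''] by blast
    have "sat p g (Digit p (Var 0) c (Var 1) 3)"
      unfolding sat_Digit[OF p] using g D1 by (intro conjI exI[of _ k]) (simp_all add: agree_def)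
    moreover have "sat p g (Digit p (Var (12 + i)) b (Var 1) 6)"
      unfolding sat_Digit[OF p] using g D2 by (intro conjI exI[of _ k]) (simp_all add: agree_def)
    \<comment> \<open>The mark for the next time sits one place higher, at
      \<open>p * p ^ k\<close>.\<close>
    moreover have "sat p g (Digit p (Var (12 + j)) 0 (times_term p (Var 1)) 9)"
      unfolding sat_Digit[OF p] eval_times_term using g D3
      by (intro conjI exI[of _ "Suc k"]) (simp_all add: agree_def)
    moreover have "g 0 = g 1 + g 2" using g *(1) by (simp add: agree_def)
    ultimately show False using L g(1) by (simp add: step_cond_def)
  qed
next
  assume R: "\<forall>k. p ^ k \<le> m \<longrightarrow> m div p ^ k mod p = c \<longrightarrow> Y i div p ^ k mod p = b \<longrightarrow>
      Y j div p ^ Suc k mod p \<noteq> 0"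
  show "\<forall>g. agree m Y g \<longrightarrow> sat p g (step_cond p i b c j)"
  proof (intro allI impI)
    fix g assume g: "agree m Y g"
    have False if le: "g 0 = g 1 + g 2"
      and D: "sat p g (Digit p (Var 0) c (Var 1) 3)" "sat p g (Digit p (Var (12 + i)) b (Var 1) 6)"
        "sat p g (Digit p (Var (12 + j)) 0 (times_term p (Var 1)) 9)"
    proof -
      obtain k where k: "g 1 = p ^ k" using sat_DigitD(1)[OF p c D(1)] by auto
      have "p ^ k \<le> m" using le k g by (simp add: agree_def)
      moreover have "m div p ^ k mod p = c"
        using sat_DigitD(2)[OF p c D(1)] k g by (simp add: agree_def)
      moreover have "Y i div p ^ k mod p = b"
        using sat_DigitD(2)[OF p b D(2)] k g by (simp add: agree_def)
      moreover have "Y j div p ^ Suc k mod p = 0"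
        using sat_DigitD(2)[OF p _ D(3)] p k g by (simp add: agree_def eval_times_term)
      ultimately show False using R[rule_format, of k] by simp
    qed
    then show "sat p g (step_cond p i b c j)" unfolding step_cond_def sat.simps eval_term.simps by blast
  qed
qed

lemma final_cond_iff:
  assumes p: "p \<ge> 2" and b: "b < p"
  shows "(\<forall>g. agree m Y g \<longrightarrow> sat p g (final_cond p i b)) \<longleftrightarrow>
    (\<forall>k. m < p ^ k \<longrightarrow> Y i div p ^ k mod p \<noteq> b)"
proof
  assume L: "\<forall>g. agree m Y g \<longrightarrow> sat p g (final_cond p i b)"
  show "\<forall>k. m < p ^ k \<longrightarrow> Y i div p ^ k mod p \<noteq> b"
  proof (intro allI impI notI)
    fix k assume *: "m < p ^ k" "Y i div p ^ k mod p = b"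
    obtain u z w where D: "Y i = u + (b * p ^ k + w)" "p ^ k = u + z + 1" "p * p ^ k dvd w"
      using digit_decomposition[OF p refl b, of "Y i" k] *(2) by auto
    obtain g where g: "agree m Y g" "g 1 = p ^ k" "g 2 = p ^ k - m - 1" "g 3 = u" "g 4 = z" "g 5 = w"
      using ex_agree[of m Y "p ^ k" "p ^ k - m - 1" u z w] by blast
    have "sat p g (Digit p (Var (12 + i)) b (Var 1) 3)"
      unfolding sat_Digit[OF p] using g D by (intro conjI exI[of _ k]) (simp_all add: agree_def)
    moreover have "g 1 = g 0 + g 2 + 1" using g *(1) by (simp add: agree_def)
    ultimately show False using L g(1) by (simp add: final_cond_def)
  qed
next
  assume R: "\<forall>k. m < p ^ k \<longrightarrow> Y i div p ^ k mod p \<noteq> b"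
  show "\<forall>g. agree m Y g \<longrightarrow> sat p g (final_cond p i b)"
  proof (intro allI impI)
    fix g assume g: "agree m Y g"
    have False if le: "g 1 = g 0 + g 2 + 1"
      and D: "sat p g (Digit p (Var (12 + i)) b (Var 1) 3)"
    proof -
      obtain k where k: "g 1 = p ^ k" using sat_DigitD(1)[OF p b D] by auto
      have "m < p ^ k" using le k g by (simp add: agree_def)
      moreover have "Y i div p ^ k mod p = b"
        using sat_DigitD(2)[OF p b D] k g by (simp add: agree_def)
      ultimately show False using R[rule_format, of k] by simp
    qed
    then show "sat p g (final_cond p i b)" unfolding final_cond_def sat.simps eval_term.simps by blast
  qed
qed

section \<open>Assembling the formula\<close>

text \<open>\<open>Digit\<close> names a concrete digit, so a nonzero mark is split into the cases
  \<open>b\<close> from 1 to \<open>p - 1\<close>, and the transition into one case for each digit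
  \<open>c\<close> of \<open>m\<close>.\<close>

definition conds :: "nat \<Rightarrow> nat \<Rightarrow> nat \<Rightarrow> (nat \<Rightarrow> nat \<Rightarrow> nat) \<Rightarrow> (nat \<Rightarrow> bool) \<Rightarrow> ba_form list" where
  "conds p n i\<^sub>0 \<delta> rej = init_cond p i\<^sub>0 #
    [step_cond p i b c (\<delta> i c). i \<leftarrow> [0..<n], b \<leftarrow> [1..<p], c \<leftarrow> [0..<p]] @
    [final_cond p i b. i \<leftarrow> filter rej [0..<n], b \<leftarrow> [1..<p]]"

lemma ball_conds:
  "(\<forall>\<phi>\<in>set (conds p n i\<^sub>0 \<delta> rej). P \<phi>) \<longleftrightarrow> P (init_cond p i\<^sub>0) \<and>
    (\<forall>i<n. \<forall>b\<in>{1..<p}. \<forall>c<p. P (step_cond p i b c (\<delta> i c))) \<and>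
    (\<forall>i<n. rej i \<longrightarrow> (\<forall>b\<in>{1..<p}. P (final_cond p i b)))"
  by (simp add: conds_def ball_Un) (simp add: Ball_def imp_conjL)

text \<open>The universal quantifier distributes over the conjunction; then the cases for fixed
  \<open>b\<close> and \<open>c\<close> recombine, since every digit is one of these values.\<close>

lemma conds_iff_marking:
  assumes p: "p \<ge> 2"
  shows "(\<forall>g. agree m Y g \<longrightarrow> sat p g (Conjs (conds p n i\<^sub>0 \<delta> rej))) \<longleftrightarrow>
    Y i\<^sub>0 mod p \<noteq> 0 \<and>
    (\<forall>i<n. \<forall>k. p ^ k \<le> m \<longrightarrow> Y i div p ^ k mod p \<noteq> 0 \<longrightarrow>
      Y (\<delta> i (m div p ^ k mod p)) div p ^ Suc k mod p \<noteq> 0) \<and>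
    (\<forall>i<n. \<forall>k. rej i \<longrightarrow> m < p ^ k \<longrightarrow> Y i div p ^ k mod p = 0)" (is "?L \<longleftrightarrow> ?R")
proof -
  have "?L \<longleftrightarrow> (\<forall>\<phi>\<in>set (conds p n i\<^sub>0 \<delta> rej). \<forall>g. agree m Y g \<longrightarrow> sat p g \<phi>)"
    by (auto simp: sat_Conjs)
  also have "\<dots> \<longleftrightarrow> (\<forall>g. agree m Y g \<longrightarrow> sat p g (init_cond p i\<^sub>0)) \<and>
    (\<forall>i<n. \<forall>b\<in>{1..<p}. \<forall>c<p. \<forall>g. agree m Y g \<longrightarrow> sat p g (step_cond p i b c (\<delta> i c))) \<and>
    (\<forall>i<n. rej i \<longrightarrow> (\<forall>b\<in>{1..<p}. \<forall>g. agree m Y g \<longrightarrow> sat p g (final_cond p i b)))"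
    unfolding ball_conds ..
  also have "\<dots> \<longleftrightarrow> Y i\<^sub>0 mod p \<noteq> 0 \<and>
    (\<forall>i<n. \<forall>b\<in>{1..<p}. \<forall>c<p. \<forall>k. p ^ k \<le> m \<longrightarrow> m div p ^ k mod p = c \<longrightarrow>
      Y i div p ^ k mod p = b \<longrightarrow> Y (\<delta> i c) div p ^ Suc k mod p \<noteq> 0) \<and>
    (\<forall>i<n. rej i \<longrightarrow> (\<forall>b\<in>{1..<p}. \<forall>k. m < p ^ k \<longrightarrow> Y i div p ^ k mod p \<noteq> b))"
    using p by (simp add: init_cond_iff step_cond_iff final_cond_iff)
  also have "\<dots> \<longleftrightarrow> ?R"
  proof -
    have less: "x mod p < p" and zero: "x mod p = 0 \<longleftrightarrow> x mod p \<notin> {1..<p}" for x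
      using p by auto
    have "(\<forall>b\<in>{1..<p}. \<forall>c<p. \<forall>k. A k \<longrightarrow> x k mod p = c \<longrightarrow> y k mod p = b \<longrightarrow> Q c k) \<longleftrightarrow>
      (\<forall>k. A k \<longrightarrow> y k mod p \<noteq> 0 \<longrightarrow> Q (x k mod p) k)" for A Q and x y :: "nat \<Rightarrow> nat"
      unfolding zero using less by blast
    moreover have "(\<forall>b\<in>{1..<p}. \<forall>k. A k \<longrightarrow> y k mod p \<noteq> b) \<longleftrightarrow>
      (\<forall>k. A k \<longrightarrow> y k mod p = 0)" for A and y :: "nat \<Rightarrow> nat"
      unfolding zero by blast
    ultimately show ?thesis by simp
  qed
  finally show ?thesis .
qed

lemma conds_fv_qfree:
  assumes "\<phi> \<in> set (conds p n i\<^sub>0 \<delta> rej)" "i\<^sub>0 < n"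
    and \<delta>: "\<And>i c. i < n \<Longrightarrow> c < p \<Longrightarrow> \<delta> i c < n"
  shows "fv \<phi> \<subseteq> {..<12 + n}" "qfree \<phi>"
proof -
  \<comment> \<open>The bound \<open>v < 10\<close> keeps \<open>v + 2\<close> below 12.\<close>
  have digit: "fv (Digit p t c P v) \<subseteq> {..<12 + n}"
    if "fv_term t \<subseteq> {..<12 + n}" "fv_term P \<subseteq> {..<12 + n}" "v < 10" for t c P v
    using fv_Digit[of p t c P v] that by fastforce
  have times: "fv_term (times_term p (Var 1)) \<subseteq> {..<12 + n}"
    using fv_times_term[of p "Var 1"] by auto
  have step: "fv (step_cond p i b c j) \<subseteq> {..<12 + n}" if "i < n" "j < n" for i b c j
    unfolding step_cond_def using that times by (simp add: digit)
  have init: "fv (init_cond p i\<^sub>0) \<subseteq> {..<12 + n}"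
    unfolding init_cond_def using assms(2) by (simp add: digit)
  have final: "fv (final_cond p i b) \<subseteq> {..<12 + n}" if "i < n" for i b
    unfolding final_cond_def using that by (simp add: digit)
  have "\<forall>\<phi>\<in>set (conds p n i\<^sub>0 \<delta> rej). fv \<phi> \<subseteq> {..<12 + n}"
    unfolding ball_conds by (intro conjI allI ballI impI init step final \<delta>)
  then show "fv \<phi> \<subseteq> {..<12 + n}" using assms(1) by (rule bspec)
  have "\<forall>\<phi>\<in>set (conds p n i\<^sub>0 \<delta> rej). qfree \<phi>"
    unfolding ball_conds by (simp add: init_cond_def step_cond_def final_cond_def qfree_Digit)
  then show "qfree \<phi>" using assms(1) by (rule bspec)
qed

text \<open>The marks, from variable 12 on, form the existential block, variables 1 to 11 the
  universal one, and variable 0 stays free for \<open>m\<close>. A state rejects if its language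
  lacks 0.\<close>

lemma Sigma_2_automaton:
  fixes K :: "nat \<Rightarrow> nat set"
  assumes p: "p \<ge> 2" and i\<^sub>0: "i\<^sub>0 < n"
    and \<delta>: "\<And>i c. i < n \<Longrightarrow> c < p \<Longrightarrow> \<delta> i c < n"
    and K: "\<And>i c. i < n \<Longrightarrow> c < p \<Longrightarrow> K (\<delta> i c) = {m. p * m + c \<in> K i}"
  shows "K i\<^sub>0 \<in> Sigma_BA 2 p"
proof -
  let ?cs = "conds p n i\<^sub>0 \<delta> (\<lambda>i. 0 \<notin> K i)"
  let ?M = "Conjs ?cs"
  define \<phi> where "\<phi> = foldr Ex [12..<12 + n] (foldr All [1..<12] ?M)"
  have cs: "fv \<psi> \<subseteq> {..<12 + n}" "qfree \<psi>" if "\<psi> \<in> set ?cs" for \<psi>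
    using conds_fv_qfree[OF that i\<^sub>0] \<delta> by blast+
  have M_fv: "fv ?M \<subseteq> {..<12 + n}" unfolding fv_Conjs using cs(1) by blast
  have "is_Sigma 2 \<phi>"
    unfolding \<phi>_def by (rule is_Sigma_2_Exs_Alls) (use cs(2) in \<open>auto simp: qfree_Conjs\<close>)
  moreover have "fv \<phi> \<subseteq> {0}"
    using M_fv by (auto simp: \<phi>_def fv_Exs fv_Alls)
  moreover have "sat p ((\<lambda>_. 0)(0 := m)) \<phi> \<longleftrightarrow> m \<in> K i\<^sub>0" for m
  proof -
    let ?e = "(\<lambda>_. 0)(0 := m)"
    have "sat p ?e \<phi> \<longleftrightarrow> (\<exists>f. (\<forall>v. v \<notin> {12..<12 + n} \<longrightarrow> f v = ?e v) \<and>
      (\<forall>g. (\<forall>v. v \<notin> {1..<12} \<longrightarrow> g v = f v) \<longrightarrow> sat p g ?M))"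
      unfolding \<phi>_def sat_Exs sat_Alls by simp
    also have "\<dots> \<longleftrightarrow> (\<exists>Y. \<forall>g. agree m Y g \<longrightarrow> sat p g ?M)"
    proof
      assume "\<exists>f. (\<forall>v. v \<notin> {12..<12 + n} \<longrightarrow> f v = ?e v) \<and>
        (\<forall>g. (\<forall>v. v \<notin> {1..<12} \<longrightarrow> g v = f v) \<longrightarrow> sat p g ?M)"
      then obtain f where f: "\<forall>v. v \<notin> {12..<12 + n} \<longrightarrow> f v = ?e v"
        and M: "\<And>g. (\<forall>v. v \<notin> {1..<12} \<longrightarrow> g v = f v) \<Longrightarrow> sat p g ?M" by blast
      have "sat p g ?M" if g: "agree m (\<lambda>i. f (12 + i)) g" for g
      proof (rule M, intro allI impI)
        fix v :: nat assume v: "v \<notin> {1..<12}"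
        show "g v = f v"
        proof (cases "v = 0")
          case True
          then show ?thesis using f g by (simp add: agree_def)
        next
          case False
          then have "v = 12 + (v - 12)" using v by auto
          then show ?thesis using g unfolding agree_def by metis
        qed
      qed
      then show "\<exists>Y. \<forall>g. agree m Y g \<longrightarrow> sat p g ?M" by blast
    next
      assume "\<exists>Y. \<forall>g. agree m Y g \<longrightarrow> sat p g ?M"
      then obtain Y where Y: "\<And>g. agree m Y g \<Longrightarrow> sat p g ?M" by blast
      \<comment> \<open>Only \<open>n\<close> marks are quantified; all later variables must keep
        the default 0.\<close>
      let ?f = "\<lambda>v. if v \<in> {12..<12 + n} then Y (v - 12) else ?e v"
      have "sat p g ?M" if g: "\<forall>v. v \<notin> {1..<12} \<longrightarrow> g v = ?f v" for g
      proof -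
        \<comment> \<open>Restores \<open>Y\<close> from variable \<open>12 + n\<close> on, where
          \<open>g\<close> has the default 0; \<open>?M\<close> does not mention these
          variables.\<close>
        let ?g = "\<lambda>v. if v < 12 then g v else Y (v - 12)"
        have "agree m Y ?g" using g by (simp add: agree_def)
        moreover have "sat p g ?M \<longleftrightarrow> sat p ?g ?M"
          using M_fv g by (intro sat_cong) auto
        ultimately show ?thesis using Y by blast
      qed
      then show "\<exists>f. (\<forall>v. v \<notin> {12..<12 + n} \<longrightarrow> f v = ?e v) \<and>
        (\<forall>g. (\<forall>v. v \<notin> {1..<12} \<longrightarrow> g v = f v) \<longrightarrow> sat p g ?M)"
        by (intro exI[of _ ?f]) auto
    qed
    also have "\<dots> \<longleftrightarrow> m \<in> K i\<^sub>0"
      unfolding conds_iff_marking[OF p] by (rule accepts_iff_marking[OF p i\<^sub>0, symmetric])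
        (erule (1) \<delta>, erule (1) K)
    finally show ?thesis .
  qed
  ultimately show ?thesis unfolding Sigma_BA_def by (intro CollectI exI[of _ 0] exI[of _ \<phi>]) auto
qed

theorem theorem2:
  fixes p :: nat
  assumes "p \<ge> 2"
  shows "Sigma_BA 2 p = BA p"
proof
  show "Sigma_BA 2 p \<subseteq> BA p" unfolding BA_def by (rule UN_upper) simp
  show "BA p \<subseteq> Sigma_BA 2 p"
  proof
    fix A assume "A \<in> BA p"
    with assms obtain F where F: "finite F" "A \<in> F"
      "\<And>S c. S \<in> F \<Longrightarrow> c < p \<Longrightarrow> {m. p * m + c \<in> S} \<in> F"
      using finite_residuals_definable by blast
    obtain n :: nat and K where "F = K ` {i. i < n}"
      using finite_imp_nat_seg_image_inj_on[OF F(1)] by blast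
    then have K: "F = K ` {..<n}" by (simp add: lessThan_def)
    obtain i\<^sub>0 where i\<^sub>0: "i\<^sub>0 < n" "A = K i\<^sub>0" using F(2) K by auto
    \<comment> \<open>With the members of \<open>F\<close> numbered as states, closure under
      residuals provides the transition function.\<close>
    have "\<exists>j<n. K j = {m. p * m + c \<in> K i}" if "i < n" "c < p" for i c
      using F(3)[of "K i" c] that K by auto
    then obtain \<delta> where
      \<delta>: "\<And>i c. i < n \<Longrightarrow> c < p \<Longrightarrow> \<delta> i c < n \<and> K (\<delta> i c) = {m. p * m + c \<in> K i}"
      by metis
    show "A \<in> Sigma_BA 2 p"
      unfolding i\<^sub>0(2) using assms i\<^sub>0(1) \<delta> by (intro Sigma_2_automaton[of p i\<^sub>0 n \<delta>]) auto
  qed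
qed

end
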